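(* Let the stopping model $\mathcal{N}=\{N_\eta: h_{N_\eta},\ \eta\in[\eta_0,\infty)\}$ be uniparametric and closed under pgf composition, parametrized by $\eta=-\log\Pr(N_\eta=1)$. Then: 1. if $\eta_0=0$, then $max_{\mathcal{N}}(\cdot)$, $min_{\mathcal{N}}(\cdot)$, $max^{-1}_{\mathcal{N}}(\cdot)$ and $min^{-1}_{\mathcal{N}}(\cdot)$ are statistical model extensions that are statistically stable; 2. if $\eta_0>0$, then for every statistical model $\mathcal{X}$: $max_{\mathcal{N}}(\mathcal{X})$ is contracted by $max_{\mathcal{N}}(\cdot)$, $min_{\mathcal{N}}(\mathcal{X})$ is contracted by $min_{\mathcal{N}}(\cdot)$, $max^{-1}_{\mathcal{N}}(\mathcal{X})$ is contracted by $max^{-1}_{\mathcal{N}}(\cdot)$, and $min^{-1}_{\mathcal{N}}(\mathcal{X})$ is contracted by $min^{-1}_{\mathcal{N}}(\cdot)$.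
   Context: A statistical model $\mathcal{X}=\{X_\theta:\theta\in\Theta\}$ is a family of real random variables, identified with the set of their cumulative distribution functions $F_{X_\theta}$. Models are compared as sets of distributions. A stopping model $\mathcal{N}=\{N_\delta:\delta\in\mathcal{D}\}$ is a family of positive integer valued random variables ($\Pr(N_\delta=0)=0$), with probability generating functions (pgfs) $h_{N_\delta}(t)=\sum_{i\ge1}p_i(\delta)t^i$, $p_i(\delta)=\Pr(N_\delta=i)$, $t\in[0,1]$. Each $h_{N_\delta}$ is an increasing bijection of $[0,1]$ with inverse $h_{N_\delta}^{-1}$, and $\overline{h}_{N_\delta}(t)=1-h_{N_\delta}(1-t)$ is its conjugate, with inverse $\overline{h}_{N_\delta}^{-1}$. $\mathcal{N}$ is closed under pgf composition if for all $N_{\delta_1},N_{\delta_2}\in\mathcal{N}$ the random variable with pgf $h_{N_{\delta_1}}\circ h_{N_{\delta_2}}$ belongs to $\mathcal{N}$. $\mathcal{N}$ is "uniparametric and closed under pgf composition" if it is closed under pgf composition and has a parametrization $\delta\in\mathcal{D}$ in which every $p_i(\delta)$ is continuously differentiable in $\delta$ and $\mathcal{D}$ is a connected subset of $\mathbb{R}$ with non-empty interior. By the paper's standing convention such models are parametrized by $\eta=-\log\Pr(N_\eta=1)$ (with $\Pr(N_\eta=1)>0$), with parameter space $[\eta_0,\infty)$, $\eta_0\ge0$, each $\eta$ corresponding to exactly one distribution in $\mathcal{N}$. Basic transformations: $max_{\mathcal{N}}(\mathcal{X})$, $max^{-1}_{\mathcal{N}}(\mathcal{X})$, $min_{\mathcal{N}}(\mathcal{X})$,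 $min^{-1}_{\mathcal{N}}(\mathcal{X})$ are the models consisting of the random variables with cdfs, respectively, $h_{N_\eta}(F_{X_\theta})$, $h^{-1}_{N_\eta}(F_{X_\theta})$, $\overline{h}_{N_\eta}(F_{X_\theta})$, $\overline{h}^{-1}_{N_\eta}(F_{X_\theta})$, for $\theta\in\Theta$ and $\eta\in[\eta_0,\infty)$. A model transformation $\mathcal{T}$ is a model extension if $\mathcal{X}\subseteq\mathcal{T}(\mathcal{X})$ for all $\mathcal{X}$; $\mathcal{X}$ is contracted by $\mathcal{T}$ if $\mathcal{T}(\mathcal{X})\subseteq\mathcal{X}$; $\mathcal{T}$ is statistically stable if $\mathcal{T}(\mathcal{T}(\mathcal{X}))=\mathcal{T}(\mathcal{X})$ for every statistical model $\mathcal{X}$. Inclusions need not be strict. *)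

theory Defs
  imports "HOL-Probability.Probability"
begin

(* A statistical model is represented by the set of the cumulative distribution
   functions of its members; the parameter space only serves as an index set. *)
definition statistical_model :: "(real \<Rightarrow> real) set \<Rightarrow> bool" where
  "statistical_model X \<longleftrightarrow> (\<forall>F\<in>X. \<exists>M. real_distribution M \<and> F = cdf M)"

type_synonym transformation = "(real \<Rightarrow> real) set \<Rightarrow> (real \<Rightarrow> real) set"

definition model_transformation :: "transformation \<Rightarrow> bool" where
  "model_transformation T \<longleftrightarrow> (\<forall>X. statistical_model X \<longrightarrow> statistical_model (T X))"

definition model_extension :: "transformation \<Rightarrow> bool" where
  "model_extension T \<longleftrightarrow>
     model_transformation T \<and> (\<forall>X. statistical_model X \<longrightarrow> X \<subseteq> T X)"

definition contracted_by :: "(real \<Rightarrow> real) set \<Rightarrow> transformation \<Rightarrow> bool" where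
  "contracted_by X T \<longleftrightarrow> model_transformation T \<and> T X \<subseteq> X"

definition statistically_stable :: "transformation \<Rightarrow> bool" where
  "statistically_stable T \<longleftrightarrow>
     model_transformation T \<and> (\<forall>X. statistical_model X \<longrightarrow> T (T X) = T X)"

definition stopping_model :: "nat pmf set \<Rightarrow> bool" where
  "stopping_model S \<longleftrightarrow> (\<forall>p\<in>S. pmf p 0 = 0)"

(* Only values at t in {0..1} are ever used. For members of a stopping model the
   term for i = 0 vanishes. *)
definition pgf :: "nat pmf \<Rightarrow> real \<Rightarrow> real" where
  "pgf p t = (\<Sum>i. pmf p i * t ^ i)"

definition pgf_inv :: "nat pmf \<Rightarrow> real \<Rightarrow> real" where
  "pgf_inv p = the_inv_into {0..1} (pgf p)"

definition conj_pgf :: "nat pmf \<Rightarrow> real \<Rightarrow> real" where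
  "conj_pgf p t = 1 - pgf p (1 - t)"

definition conj_pgf_inv :: "nat pmf \<Rightarrow> real \<Rightarrow> real" where
  "conj_pgf_inv p = the_inv_into {0..1} (conj_pgf p)"

definition closed_under_pgf_composition :: "nat pmf set \<Rightarrow> bool" where
  "closed_under_pgf_composition S \<longleftrightarrow>
     (\<forall>p\<in>S. \<forall>q\<in>S. \<exists>r\<in>S. \<forall>t\<in>{0..1}. pgf r t = pgf p (pgf q t))"

(* Unlike C1_differentiable_on, this uses derivatives within D, hence one-sided ones
   at end points of D: a parametrization is meaningful on its parameter space only. *)
definition continuously_differentiable_on :: "(real \<Rightarrow> real) \<Rightarrow> real set \<Rightarrow> bool" where
  "continuously_differentiable_on f D \<longleftrightarrow>
     (\<exists>f'. continuous_on D f' \<and> (\<forall>d\<in>D. (f has_real_derivative f' d) (at d within D)))"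

definition uniparametric :: "nat pmf set \<Rightarrow> bool" where
  "uniparametric S \<longleftrightarrow>
     (\<exists>(D :: real set) (P :: real \<Rightarrow> nat pmf).
        connected D \<and> interior D \<noteq> {} \<and> S = P ` D \<and>
        (\<forall>i\<ge>1. continuously_differentiable_on (\<lambda>d. pmf (P d) i) D))"

definition max_model :: "nat pmf set \<Rightarrow> transformation" where
  "max_model S X = {\<lambda>x. pgf p (F x) | p F. p \<in> S \<and> F \<in> X}"

definition max_inv_model :: "nat pmf set \<Rightarrow> transformation" where
  "max_inv_model S X = {\<lambda>x. pgf_inv p (F x) | p F. p \<in> S \<and> F \<in> X}"

definition min_model :: "nat pmf set \<Rightarrow> transformation" where
  "min_model S X = {\<lambda>x. conj_pgf p (F x) | p F. p \<in> S \<and> F \<in> X}"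

definition min_inv_model :: "nat pmf set \<Rightarrow> transformation" where
  "min_inv_model S X = {\<lambda>x. conj_pgf_inv p (F x) | p F. p \<in> S \<and> F \<in> X}"

end

theory Submission
  imports Defs
begin

text \<open>
  The random variables play no part beyond their cdfs: each of the four transformations composes
  the cdfs of a model with the members of a family of increasing homeomorphisms of
  \<open>{0..1}\<close>, called distortions below. Such a homeomorphism carries cdfs to cdfs, as it
  preserves monotonicity, right continuity and the limits \<open>0\<close> and \<open>1\<close> at
  infinity. If the family is closed under composition, applying the transformation twice yields
  nothing that one application does not, which is the contraction property
  (\<open>distort_distort_subset\<close>). If the family contains the identity as well, every model
  is included in its transform, and contraction together with extension gives stability
  (\<open>distort_extension_stable\<close>).

  A pgf without mass at \<open>0\<close> and with positive mass at \<open>1\<close> is a distortion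
  (\<open>distortion_pgf\<close>): its terms are nondecreasing, and the linear one is strictly
  increasing. Passing to inverses or to conjugates turns a composition closed family of distortions
  into another one (\<open>distortion_semigroup_inverse\<close>,
  \<open>distortion_semigroup_conjugate\<close>), so all four transformations are covered by the
  same argument. Finally, \<open>\<eta> = 0\<close> means \<open>Pr(N = 1) = 1\<close>, and the pgf
  of this degenerate variable is the identity.
\<close>

section \<open>Distortions of the unit interval\<close>

definition distortion :: "(real \<Rightarrow> real) \<Rightarrow> bool" where
  "distortion \<phi> \<longleftrightarrow>
     continuous_on {0..1} \<phi> \<and> strict_mono_on {0..1} \<phi> \<and> \<phi> 0 = 0 \<and> \<phi> 1 = 1"

definition conjugate :: "(real \<Rightarrow> real) \<Rightarrow> real \<Rightarrow> real" where
  "conjugate \<phi> t = 1 - \<phi> (1 - t)"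

lemma distortion_mono:
  assumes "distortion \<phi>" "s \<in> {0..1}" "t \<in> {0..1}" "s \<le> t"
  shows "\<phi> s \<le> \<phi> t"
  using assms by (auto simp: distortion_def strict_mono_on_leD)

lemma distortion_mem:
  assumes "distortion \<phi>" "t \<in> {0..1}"
  shows "\<phi> t \<in> {0..1}"
  using distortion_mono[of \<phi> 0 t] distortion_mono[of \<phi> t 1] assms
  by (auto simp: distortion_def)

lemma distortion_bij:
  assumes "distortion \<phi>"
  shows "bij_betw \<phi> {0..1} {0..1}"
proof -
  have "{0..1} \<subseteq> \<phi> ` {0..1}"
  proof
    fix y :: real assume "y \<in> {0..1}"
    then have "\<exists>x. 0 \<le> x \<and> x \<le> 1 \<and> \<phi> x = y"
      using assms by (intro IVT') (auto simp: distortion_def)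
    then show "y \<in> \<phi> ` {0..1}" by auto
  qed
  moreover have "inj_on \<phi> {0..1}"
    using assms by (auto simp: distortion_def intro: strict_mono_on_imp_inj_on)
  ultimately show ?thesis
    using distortion_mem[OF assms] by (auto simp: bij_betw_def)
qed

lemma distortion_inverse_mem:
  assumes "distortion \<phi>" "t \<in> {0..1}"
  shows "the_inv_into {0..1} \<phi> t \<in> {0..1}"
  using distortion_bij[OF assms(1)] assms(2)
  by (metis bij_betw_def order_refl the_inv_into_into)

lemma distortion_inverse:
  assumes "distortion \<phi>"
  shows "distortion (the_inv_into {0..1} \<phi>)"
proof -
  let ?\<psi> = "the_inv_into {0..1} \<phi>"
  note bij = distortion_bij[OF assms]
  have inj: "inj_on \<phi> {0..1}" and img: "\<phi> ` {0..1} = {0..1}"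
    using bij by (auto simp: bij_betw_def)
  have "continuous_on (\<phi> ` {0..1}) ?\<psi>"
    using assms inj by (intro continuous_on_inv_into) (auto simp: distortion_def)
  then have "continuous_on {0..1} ?\<psi>"
    by (simp only: img)
  moreover have "strict_mono_on {0..1} ?\<psi>"
  proof (rule strict_mono_onI)
    fix s t :: real assume st: "s \<in> {0..1}" "t \<in> {0..1}" "s < t"
    show "?\<psi> s < ?\<psi> t"
    proof (rule ccontr)
      assume "\<not> ?\<psi> s < ?\<psi> t"
      then have "\<phi> (?\<psi> t) \<le> \<phi> (?\<psi> s)"
        using st by (intro distortion_mono[OF assms] distortion_inverse_mem[OF assms]) auto
      then show False
        using st f_the_inv_into_f_bij_betw[OF bij] by simp
    qed
  qed
  moreover have "?\<psi> 0 = 0" "?\<psi> 1 = 1"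
    using the_inv_into_f_f[OF inj, of 0] the_inv_into_f_f[OF inj, of 1] assms
    by (auto simp: distortion_def)
  ultimately show ?thesis
    by (simp add: distortion_def)
qed

lemma distortion_conjugate:
  assumes "distortion \<phi>"
  shows "distortion (conjugate \<phi>)"
proof -
  have "continuous_on {0..1} (\<lambda>t. \<phi> (1 - t))"
    using assms
    by (intro continuous_on_compose2[of "{0..1}" \<phi> "{0..1}" "\<lambda>t. 1 - t"])
       (auto simp: distortion_def intro!: continuous_intros)
  then have "continuous_on {0..1} (conjugate \<phi>)"
    unfolding conjugate_def by (intro continuous_intros)
  moreover have "strict_mono_on {0..1} (conjugate \<phi>)"
    using assms by (auto simp: distortion_def conjugate_def strict_mono_on_def)
  ultimately show ?thesis
    using assms by (auto simp: distortion_def conjugate_def)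
qed

text \<open>
  Monotonicity of a distortion is known on \<open>{0..1}\<close> only, but a cdf takes all its values
  there. The limit at \<open>-\<infinity>\<close> equals \<open>\<phi> 0 = 0\<close> because
  \<open>\<phi>\<close> is continuous at \<open>0\<close> relative to \<open>{0..1}\<close>, and similarly
  for the limit at \<open>\<infinity>\<close> and the right continuity.
\<close>

lemma cdf_distortion:
  assumes \<phi>: "distortion \<phi>" and M: "real_distribution M"
  shows "\<exists>M'. real_distribution M' \<and> (\<lambda>x. \<phi> (cdf M x)) = cdf M'"
proof -
  interpret real_distribution M by fact
  let ?F = "\<lambda>x. \<phi> (cdf M x)"
  have range: "cdf M x \<in> {0..1}" for x
    by (simp add: cdf_nonneg cdf_bounded_prob)
  have lim: "((\<lambda>x. \<phi> (cdf M x)) \<longlongrightarrow> \<phi> l) A"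
    if "(cdf M \<longlongrightarrow> l) A" "l \<in> {0..1}" for l and A :: "real filter"
    using \<phi> that range
    by (intro continuous_on_tendsto_compose[of "{0..1}" \<phi>]) (auto simp: distortion_def)
  have mono: "?F x \<le> ?F y" if "x \<le> y" for x y
    using \<phi> range range cdf_nondecreasing[OF that] by (rule distortion_mono)
  have right_cont: "continuous (at_right a) ?F" for a
    using lim[OF _ range] cdf_is_right_cont[of a] unfolding continuous_within by blast
  have bot: "(?F \<longlongrightarrow> 0) at_bot" and top: "(?F \<longlongrightarrow> 1) at_top"
    using lim[OF cdf_lim_at_bot] lim[OF cdf_lim_at_top_prob] \<phi>
    by (auto simp: distortion_def)
  show ?thesis
    using real_distribution_interval_measure[OF mono right_cont bot top]
      cdf_interval_measure[OF mono right_cont bot]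
    by metis
qed

section \<open>Transforming a model by a family of distortions\<close>

definition distort :: "(real \<Rightarrow> real) set \<Rightarrow> transformation" where
  "distort G X = {\<lambda>x. \<phi> (F x) | \<phi> F. \<phi> \<in> G \<and> F \<in> X}"

text \<open>
  The composition is required to agree with a member of the family on \<open>{0..1}\<close> only: the
  functions are applied to values of cdfs, and outside \<open>{0..1}\<close> a pgf may diverge and
  its inverse is unspecified.
\<close>

definition distortion_semigroup :: "(real \<Rightarrow> real) set \<Rightarrow> bool" where
  "distortion_semigroup G \<longleftrightarrow> (\<forall>\<phi>\<in>G. distortion \<phi>) \<and>
     (\<forall>\<phi>\<in>G. \<forall>\<psi>\<in>G. \<exists>\<omega>\<in>G. \<forall>t\<in>{0..1}. \<omega> t = \<phi> (\<psi> t))"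

lemma statistical_model_range:
  assumes "statistical_model X" "F \<in> X"
  shows "F x \<in> {0..1}"
proof -
  obtain M where "real_distribution M" and F: "F = cdf M"
    using assms by (auto simp: statistical_model_def)
  then interpret real_distribution M by simp
  show ?thesis by (simp add: F cdf_nonneg cdf_bounded_prob)
qed

lemma model_transformation_distort:
  assumes "\<forall>\<phi>\<in>G. distortion \<phi>"
  shows "model_transformation (distort G)"
  unfolding model_transformation_def
proof (intro allI impI)
  fix X assume X: "statistical_model X"
  show "statistical_model (distort G X)"
    unfolding statistical_model_def
  proof
    fix H assume "H \<in> distort G X"
    then obtain \<phi> F where \<phi>: "\<phi> \<in> G" and "F \<in> X" and H: "H = (\<lambda>x. \<phi> (F x))"
      unfolding distort_def by blast
    then obtain M where "real_distribution M" "F = cdf M"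
      using X by (auto simp: statistical_model_def)
    then show "\<exists>M. real_distribution M \<and> H = cdf M"
      using cdf_distortion[of \<phi> M] assms \<phi> H by simp
  qed
qed

lemma distort_distort_subset:
  assumes G: "distortion_semigroup G" and X: "statistical_model X"
  shows "distort G (distort G X) \<subseteq> distort G X"
proof
  fix H assume "H \<in> distort G (distort G X)"
  then obtain \<phi> \<psi> F where "\<phi> \<in> G" "\<psi> \<in> G" and F: "F \<in> X"
    and H: "H = (\<lambda>x. \<phi> (\<psi> (F x)))"
    unfolding distort_def by blast
  then obtain \<omega> where \<omega>: "\<omega> \<in> G" "\<forall>t\<in>{0..1}. \<omega> t = \<phi> (\<psi> t)"
    using G unfolding distortion_semigroup_def by blast
  have "H = (\<lambda>x. \<omega> (F x))"
    using \<omega>(2) statistical_model_range[OF X F] by (auto simp: H)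
  then show "H \<in> distort G X"
    using \<omega>(1) F unfolding distort_def by blast
qed

lemma distort_contracted:
  assumes "distortion_semigroup G" "statistical_model X"
  shows "contracted_by (distort G X) (distort G)"
  using distort_distort_subset[OF assms] assms(1) model_transformation_distort
  by (auto simp: contracted_by_def distortion_semigroup_def)

text \<open>
  Stability needs no separate argument: the inclusion \<open>distort G X \<subseteq> distort G (distort G X)\<close>
  is the extension property applied to the model \<open>distort G X\<close>.
\<close>

lemma distort_extension_stable:
  assumes G: "distortion_semigroup G" and \<iota>: "\<iota> \<in> G" "\<forall>t\<in>{0..1}. \<iota> t = t"
  shows "model_extension (distort G) \<and> statistically_stable (distort G)"
proof -
  have T: "model_transformation (distort G)"
    using G by (intro model_transformation_distort) (simp add: distortion_semigroup_def)
  have ext: "X \<subseteq> distort G X" if X: "statistical_model X" for X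
  proof
    fix F assume F: "F \<in> X"
    have "F = (\<lambda>x. \<iota> (F x))"
      using \<iota>(2) statistical_model_range[OF X F] by auto
    then show "F \<in> distort G X"
      using \<iota>(1) F unfolding distort_def by blast
  qed
  have "distort G (distort G X) = distort G X" if X: "statistical_model X" for X
    using T X ext distort_distort_subset[OF G X] unfolding model_transformation_def by blast
  with T ext show ?thesis
    by (simp add: model_extension_def statistically_stable_def)
qed

text \<open>
  Inversion reverses the order of a composition, so the inverse of \<open>\<psi> \<circ> \<phi>\<close>
  witnesses closure for the inverses of \<open>\<phi>\<close> and \<open>\<psi>\<close>, in this order.
\<close>

lemma distortion_semigroup_inverse:
  assumes G: "distortion_semigroup G"
  shows "distortion_semigroup (the_inv_into {0..1} ` G)"
  unfolding distortion_semigroup_def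
proof (intro conjI ballI)
  show "distortion \<phi>'" if "\<phi>' \<in> the_inv_into {0..1} ` G" for \<phi>'
    using that G distortion_inverse by (auto simp: distortion_semigroup_def)
next
  let ?inv = "the_inv_into {0..1::real} :: (real \<Rightarrow> real) \<Rightarrow> real \<Rightarrow> real"
  fix \<phi>' \<psi>' assume "\<phi>' \<in> ?inv ` G" "\<psi>' \<in> ?inv ` G"
  then obtain \<phi> \<psi> where \<phi>: "\<phi> \<in> G" "\<phi>' = ?inv \<phi>" and \<psi>: "\<psi> \<in> G" "\<psi>' = ?inv \<psi>"
    by blast
  obtain \<omega> where \<omega>: "\<omega> \<in> G" "\<forall>t\<in>{0..1}. \<omega> t = \<psi> (\<phi> t)"
    using G \<phi>(1) \<psi>(1) unfolding distortion_semigroup_def by blast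
  have d: "distortion \<phi>" "distortion \<psi>" "distortion \<omega>"
    using G \<phi> \<psi> \<omega> by (auto simp: distortion_semigroup_def)
  have "?inv \<omega> t = \<phi>' (\<psi>' t)" if t: "t \<in> {0..1}" for t
  proof (rule the_inv_into_f_eq)
    show "inj_on \<omega> {0..1}"
      using distortion_bij[OF d(3)] by (simp add: bij_betw_def)
    have mem: "?inv \<psi> t \<in> {0..1}" "?inv \<phi> (?inv \<psi> t) \<in> {0..1}"
      using t by (blast intro: distortion_inverse_mem d)+
    then show "\<phi>' (\<psi>' t) \<in> {0..1}"
      by (simp only: \<phi>(2) \<psi>(2))
    show "\<omega> (\<phi>' (\<psi>' t)) = t"
      using mem \<omega>(2) t f_the_inv_into_f_bij_betw[OF distortion_bij[OF d(1)]]
        f_the_inv_into_f_bij_betw[OF distortion_bij[OF d(2)]]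
      by (simp add: \<phi>(2) \<psi>(2))
  qed
  then show "\<exists>\<omega>'\<in>?inv ` G. \<forall>t\<in>{0..1}. \<omega>' t = \<phi>' (\<psi>' t)"
    using \<omega>(1) by blast
qed

text \<open>
  The conjugate of \<open>\<phi>\<close> is \<open>\<sigma> \<circ> \<phi> \<circ> \<sigma>\<close> for the involution
  \<open>\<sigma> t = 1 - t\<close>; the two inner copies of \<open>\<sigma>\<close> cancel when conjugates are
  composed.
\<close>

lemma distortion_semigroup_conjugate:
  assumes G: "distortion_semigroup G"
  shows "distortion_semigroup (conjugate ` G)"
  unfolding distortion_semigroup_def
proof (intro conjI ballI)
  show "distortion \<phi>'" if "\<phi>' \<in> conjugate ` G" for \<phi>'
    using that G distortion_conjugate by (auto simp: distortion_semigroup_def)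
next
  fix \<phi>' \<psi>' assume "\<phi>' \<in> conjugate ` G" "\<psi>' \<in> conjugate ` G"
  then obtain \<phi> \<psi> where \<phi>: "\<phi> \<in> G" "\<phi>' = conjugate \<phi>" and \<psi>: "\<psi> \<in> G" "\<psi>' = conjugate \<psi>"
    by blast
  obtain \<omega> where \<omega>: "\<omega> \<in> G" "\<forall>t\<in>{0..1}. \<omega> t = \<phi> (\<psi> t)"
    using G \<phi>(1) \<psi>(1) unfolding distortion_semigroup_def by blast
  then have "\<forall>t\<in>{0..1}. conjugate \<omega> t = \<phi>' (\<psi>' t)"
    by (simp add: \<phi>(2) \<psi>(2) conjugate_def)
  then show "\<exists>\<omega>'\<in>conjugate ` G. \<forall>t\<in>{0..1}. \<omega>' t = \<phi>' (\<psi>' t)"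
    using \<omega>(1) by blast
qed

section \<open>Probability generating functions\<close>

lemma pmf_sums_1:
  fixes p :: "nat pmf"
  shows "pmf p sums 1"
  using sums_infsetsum_nat'[of "pmf p"] infsetsum_pmf_eq_1[of p UNIV] by auto

lemma summable_pgf:
  fixes p :: "nat pmf" and t :: real
  assumes "t \<in> {0..1}"
  shows "summable (\<lambda>i. pmf p i * t ^ i)"
proof (rule summable_comparison_test')
  show "summable (pmf p)" using pmf_sums_1 by (rule sums_summable)
  show "norm (pmf p i * t ^ i) \<le> pmf p i" for i
    using assms by (simp add: abs_mult power_le_one mult_left_le)
qed

text \<open>
  Continuity up to the end point \<open>1\<close> is not a matter of the radius of convergence, which
  may be \<open>1\<close>; it follows from uniform convergence on \<open>{0..1}\<close>, where the masses
  are a summable majorant. Strict monotonicity comes from the linear term: all other terms are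
  nondecreasing.
\<close>

lemma distortion_pgf:
  assumes p0: "pmf p 0 = 0" and p1: "0 < pmf p 1"
  shows "distortion (pgf p)"
proof -
  have "uniform_limit {0..1} (\<lambda>n t. \<Sum>i<n. pmf p i * t ^ i) (\<lambda>t. \<Sum>i. pmf p i * t ^ i) sequentially"
  proof (rule Weierstrass_m_test)
    show "norm (pmf p i * t ^ i) \<le> pmf p i" if "t \<in> {0..1}" for i and t :: real
      using that by (simp add: abs_mult power_le_one mult_left_le)
    show "summable (pmf p)" using pmf_sums_1 by (rule sums_summable)
  qed
  then have "continuous_on {0..1} (\<lambda>t. \<Sum>i. pmf p i * t ^ i)"
    by (rule uniform_limit_theorem[rotated]) (auto intro!: always_eventually continuous_intros)
  then have "continuous_on {0..1} (pgf p)"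
    by (simp add: pgf_def[abs_def])
  moreover have "strict_mono_on {0..1} (pgf p)"
  proof (rule strict_mono_onI)
    fix s t :: real assume st: "s \<in> {0..1}" "t \<in> {0..1}" "s < t"
    let ?d = "\<lambda>i. pmf p i * t ^ i - pmf p i * s ^ i"
    have "0 \<le> ?d i" for i
      using st by (simp add: mult_left_mono power_mono)
    moreover have "0 < ?d 1"
      using st p1 by simp
    ultimately have "0 < (\<Sum>i. ?d i)"
      using st by (intro suminf_pos2[where i = 1] summable_diff summable_pgf) auto
    also have "\<dots> = pgf p t - pgf p s"
      unfolding pgf_def using st by (intro suminf_diff[symmetric] summable_pgf)
    finally show "pgf p s < pgf p t" by simp
  qed
  moreover have "pgf p 0 = 0"
    using p0 powser_zero[of "pmf p"] by (simp add: pgf_def)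
  moreover have "pgf p 1 = 1"
    using pmf_sums_1[of p] by (simp add: pgf_def sums_iff)
  ultimately show ?thesis
    by (simp add: distortion_def)
qed

lemma pgf_eq_id:
  assumes "pmf p 1 = 1"
  shows "pgf p t = t"
proof -
  have "measure_pmf.prob p {1} = 1"
    using assms by (simp add: pmf.rep_eq)
  then have "set_pmf p \<subseteq> {1}"
    by (auto simp: measure_pmf.prob_eq_1 AE_measure_pmf_iff)
  then have "p = return_pmf 1"
    by (simp only: set_pmf_subset_singleton)
  then have "pmf p i * t ^ i = (if i = 1 then t else 0)" for i
    by (simp add: indicator_def)
  then show ?thesis
    using sums_single[of 1 "\<lambda>_. t"] by (simp add: pgf_def sums_iff)
qed

text \<open>This is where all four transformations become instances of one construction.\<close>

lemma basic_transformations_eq_distort: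
  "max_model S = distort (pgf ` S)"
  "min_model S = distort (conjugate ` pgf ` S)"
  "max_inv_model S = distort (the_inv_into {0..1} ` pgf ` S)"
  "min_inv_model S = distort (the_inv_into {0..1} ` conjugate ` pgf ` S)"
proof -
  have conj: "conj_pgf p = conjugate (pgf p)" for p
    by (simp add: conj_pgf_def conjugate_def fun_eq_iff)
  show "max_model S = distort (pgf ` S)"
    "min_model S = distort (conjugate ` pgf ` S)"
    "max_inv_model S = distort (the_inv_into {0..1} ` pgf ` S)"
    "min_inv_model S = distort (the_inv_into {0..1} ` conjugate ` pgf ` S)"
    unfolding max_model_def min_model_def max_inv_model_def min_inv_model_def distort_def
      pgf_inv_def conj_pgf_inv_def conj
    by (intro ext; blast)+
qed

section \<open>The basic transformations of a stopping model\<close>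

theorem proposition7:
  fixes N :: "real \<Rightarrow> nat pmf" and \<eta>\<^sub>0 :: real and S :: "nat pmf set"
  assumes "0 \<le> \<eta>\<^sub>0"
    and "S = N ` {\<eta>\<^sub>0..}"
    and "stopping_model S"
    and "uniparametric S"
    and "closed_under_pgf_composition S"
    and "\<And>\<eta>. \<eta> \<in> {\<eta>\<^sub>0..} \<Longrightarrow> 0 < pmf (N \<eta>) 1 \<and> \<eta> = - ln (pmf (N \<eta>) 1)"
  shows "(\<eta>\<^sub>0 = 0 \<longrightarrow>
            (\<forall>T \<in> {max_model S, min_model S, max_inv_model S, min_inv_model S}.
               model_extension T \<and> statistically_stable T)) \<and>
         (\<eta>\<^sub>0 > 0 \<longrightarrow>
            (\<forall>X. statistical_model X \<longrightarrow>
               contracted_by (max_model S X) (max_model S) \<and>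
               contracted_by (min_model S X) (min_model S) \<and>
               contracted_by (max_inv_model S X) (max_inv_model S) \<and>
               contracted_by (min_inv_model S X) (min_inv_model S)))"
proof -
  let ?inv = "the_inv_into {0..1::real} :: (real \<Rightarrow> real) \<Rightarrow> real \<Rightarrow> real"
  let ?families = "{pgf ` S, conjugate ` pgf ` S, ?inv ` pgf ` S, ?inv ` conjugate ` pgf ` S}"
  have "distortion (pgf p)" if "p \<in> S" for p
    using that assms(2,3,6) by (intro distortion_pgf) (auto simp: stopping_model_def)
  then have "distortion_semigroup (pgf ` S)"
    using assms(5) unfolding distortion_semigroup_def closed_under_pgf_composition_def by blast
  then have semigroup: "distortion_semigroup G" if "G \<in> ?families" for G
    using that by (auto intro: distortion_semigroup_inverse distortion_semigroup_conjugate)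
  have part1: "model_extension (distort G) \<and> statistically_stable (distort G)"
    if "\<eta>\<^sub>0 = 0" and G: "G \<in> ?families" for G
  proof -
    have "pmf (N 0) 1 = 1"
      using assms(6)[of 0] \<open>\<eta>\<^sub>0 = 0\<close> ln_eq_zero_iff[of "pmf (N 0) 1"] by simp
    then have pgf_id: "pgf (N 0) = (\<lambda>t. t)"
      by (simp add: pgf_eq_id fun_eq_iff)
    have "N 0 \<in> S"
      using assms(2) \<open>\<eta>\<^sub>0 = 0\<close> by simp
    with pgf_id have id: "(\<lambda>t. t) \<in> pgf ` S"
      by (metis imageI)
    have conj_id: "conjugate (\<lambda>t. t) = (\<lambda>t. t)"
      by (simp add: conjugate_def fun_eq_iff)
    with id have cid: "(\<lambda>t. t) \<in> conjugate ` pgf ` S"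
      by (metis imageI)
    have inv_id: "\<forall>t\<in>{0..1}. ?inv (\<lambda>t. t) t = t"
      by (simp add: the_inv_into_f_eq inj_on_def)
    have "(\<lambda>t. t) \<in> G \<or> ?inv (\<lambda>t. t) \<in> G"
      using G id cid imageI[OF id, of ?inv] imageI[OF cid, of ?inv]
      by (elim insertE emptyE) (simp_all only: simp_thms)
    then show ?thesis
      using distort_extension_stable[OF semigroup[OF G]] inv_id by fast
  qed
  have part2: "contracted_by (distort G X) (distort G)"
    if "G \<in> ?families" "statistical_model X" for G X
    using distort_contracted semigroup that by blast
  show ?thesis
    unfolding basic_transformations_eq_distort using part1 part2 by blast
qed

end
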